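(* Let $k$ be a perfect field of characteristic $\neq 2$ and let $g(u)\in k[u]$ be a nonzero polynomial of even degree. Let $$S_g:=\bigl(x^2-g(u)y^2=1\bigr)\subset \mathbb{A}^3_{xyu}$$ be the corresponding Pell surface over $k$, with coordinate projection $\pi:S_g\to\mathbb{A}^1_u$. Then every (possibly singular) affine line on $S_g$ is either vertical or a section of $\pi:S_g\to\mathbb{A}^1_u$.
   Context: A (possibly singular) affine line on a quasi-affine $k$-variety $X$ is a closed curve $B\subset X$ whose normalization is isomorphic to $\mathbb{A}^1_k$. (Equivalently, these are the images of non-constant morphisms $\mathbb{A}^1_k\to X$.) A vertical affine line on $S_g$ is one of the lines $t\mapsto (x=\pm 1,\ y=t,\ u=c)$, where $c$ is a root of $g$, i.e. $g(c)=0$. A section of $\pi$ is a curve in $S_g$ of the form $\{(x(u),y(u),u)\}$ with $x(u),y(u)\in k[u]$ satisfying $x(u)^2-g(u)y(u)^2=1$, i.e. a curve mapped isomorphically onto $\mathbb{A}^1_u$ by $\pi$. *)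

theory Defs
  imports "HOL-Algebra.Algebraic_Closure_Type"
begin

definition perfect_field :: "'k::field itself \<Rightarrow> bool" where
  "perfect_field _ \<longleftrightarrow> CHAR('k) = 0 \<or> surj (\<lambda>z::'k. z ^ CHAR('k))"


section \<open>Fraction field and normalization of a domain\<close>

definition frac_rel :: "('a, 'm) ring_scheme \<Rightarrow> (('a \<times> 'a) \<times> ('a \<times> 'a)) set" where
  "frac_rel A = {((a, b), (c, d)) | a b c d.
      a \<in> carrier A \<and> b \<in> carrier A - {\<zero>\<^bsub>A\<^esub>} \<and>
      c \<in> carrier A \<and> d \<in> carrier A - {\<zero>\<^bsub>A\<^esub>} \<and>
      a \<otimes>\<^bsub>A\<^esub> d = c \<otimes>\<^bsub>A\<^esub> b}"

definition frac_class :: "('a, 'm) ring_scheme \<Rightarrow> 'a \<Rightarrow> 'a \<Rightarrow> ('a \<times> 'a) set" where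
  "frac_class A a b = frac_rel A `` {(a, b)}"

definition frac_field :: "('a, 'm) ring_scheme \<Rightarrow> ('a \<times> 'a) set ring" where
  "frac_field A =
    \<lparr>carrier = (carrier A \<times> (carrier A - {\<zero>\<^bsub>A\<^esub>})) // frac_rel A,
     monoid.mult = (\<lambda>p q. \<Union>(a, b)\<in>p. \<Union>(c, d)\<in>q. frac_class A (a \<otimes>\<^bsub>A\<^esub> c) (b \<otimes>\<^bsub>A\<^esub> d)),
     one = frac_class A \<one>\<^bsub>A\<^esub> \<one>\<^bsub>A\<^esub>,
     ring.zero = frac_class A \<zero>\<^bsub>A\<^esub> \<one>\<^bsub>A\<^esub>,
     add = (\<lambda>p q. \<Union>(a, b)\<in>p. \<Union>(c, d)\<in>q.
              frac_class A (a \<otimes>\<^bsub>A\<^esub> d \<oplus>\<^bsub>A\<^esub> c \<otimes>\<^bsub>A\<^esub> b) (b \<otimes>\<^bsub>A\<^esub> d))\<rparr>"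

definition frac_embed :: "('a, 'm) ring_scheme \<Rightarrow> 'a \<Rightarrow> ('a \<times> 'a) set" where
  "frac_embed A a = frac_class A a \<one>\<^bsub>A\<^esub>"

definition integral_elem :: "('f, 'm) ring_scheme \<Rightarrow> 'f set \<Rightarrow> 'f \<Rightarrow> bool" where
  "integral_elem F K z \<longleftrightarrow> z \<in> carrier F \<and>
     (\<exists>n c. c \<in> {..<n::nat} \<rightarrow> K \<and>
        z [^]\<^bsub>F\<^esub> n \<oplus>\<^bsub>F\<^esub> (\<Oplus>\<^bsub>F\<^esub>i\<in>{..<n}. c i \<otimes>\<^bsub>F\<^esub> z [^]\<^bsub>F\<^esub> i) = \<zero>\<^bsub>F\<^esub>)"

text \<open>The integral closure of a domain in its fraction field.\<close>

definition normalization :: "('a, 'm) ring_scheme \<Rightarrow> ('a \<times> 'a) set ring" where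
  "normalization A = (frac_field A)
     \<lparr>carrier := {z. integral_elem (frac_field A) (frac_embed A ` carrier A) z}\<rparr>"


section \<open>Affine lines in affine 3-space\<close>

text \<open>
  The coordinate ring k[x,y,u] of affine 3-space is represented by the iterated polynomial type
  k[u][y][x]; the innermost variable is u and the outermost one is x.
  A closed subscheme is given by its ideal.
\<close>

type_synonym 'k poly3 = "'k poly poly poly"

definition const3 :: "'k::field \<Rightarrow> 'k poly3" where
  "const3 c = [:[:[:c:]:]:]"

definition var_x :: "'k::field poly3" where "var_x = [:0, 1:]"
definition var_y :: "'k::field poly3" where "var_y = [:[:0, 1:]:]"

definition in_u :: "'k::field poly \<Rightarrow> 'k poly3" where
  "in_u h = [:[:h:]:]"

definition coord_ring :: "'k::field poly3 set \<Rightarrow> 'k poly3 set ring" where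
  "coord_ring P = ring_of_type_algebra Quot P"

text \<open>
  Integral closed subschemes of dimension one, i.e. prime ideals whose residue ring has Krull
  dimension one, contained in the closed subscheme with ideal I.
\<close>

definition closed_curve_in :: "'k::field poly3 set \<Rightarrow> 'k poly3 set \<Rightarrow> bool" where
  "closed_curve_in I P \<longleftrightarrow> I \<subseteq> P \<and> primeideal P ring_of_type_algebra \<and>
     \<not> maximalideal P ring_of_type_algebra \<and>
     (\<forall>Q. primeideal Q ring_of_type_algebra \<and> P \<subset> Q \<longrightarrow> maximalideal Q ring_of_type_algebra)"

text \<open>
  The normalization is required to be isomorphic to the affine line over k, hence the
  isomorphism of rings has to be the identity on k.
\<close>

definition affine_line_in :: "'k::field poly3 set \<Rightarrow> 'k poly3 set \<Rightarrow> bool" where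
  "affine_line_in I P \<longleftrightarrow> closed_curve_in I P \<and>
     (\<exists>h \<in> ring_iso (normalization (coord_ring P)) (ring_of_type_algebra :: 'k poly ring).
        \<forall>c. h (frac_embed (coord_ring P) (P +>\<^bsub>ring_of_type_algebra\<^esub> const3 c)) = [:c:])"

text \<open>F(a(t), b(t), c(t)) for F in k[x,y,u]\<close>

definition subst3 :: "'k::field poly \<Rightarrow> 'k poly \<Rightarrow> 'k poly \<Rightarrow> 'k poly3 \<Rightarrow> 'k poly" where
  "subst3 a b c F = poly (map_poly (\<lambda>G. poly (map_poly (\<lambda>h. h \<circ>\<^sub>p c) G) b) F) a"

text \<open>
  The ideal of the (closure of the) image of the morphism (a(t), b(t), c(t)) from the affine line.
  Ideals rather than sets of rational points are used since k may be finite.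
\<close>

definition param_curve :: "'k::field poly \<Rightarrow> 'k poly \<Rightarrow> 'k poly \<Rightarrow> 'k poly3 set" where
  "param_curve a b c = {F. subst3 a b c F = 0}"


section \<open>Pell surfaces\<close>

definition pell_surface :: "'k::field poly \<Rightarrow> 'k poly3 set" where
  "pell_surface g = PIdl\<^bsub>ring_of_type_algebra\<^esub> (var_x ^ 2 - in_u g * var_y ^ 2 - 1)"

definition vertical_line :: "'k::field poly \<Rightarrow> 'k poly3 set \<Rightarrow> bool" where
  "vertical_line g P \<longleftrightarrow>
     (\<exists>e c. e \<in> {1, -1} \<and> poly g c = 0 \<and> P = param_curve [:e:] [:0, 1:] [:c:])"

definition pell_section :: "'k::field poly \<Rightarrow> 'k poly3 set \<Rightarrow> bool" where
  "pell_section g P \<longleftrightarrow>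
     (\<exists>a b. a ^ 2 - g * b ^ 2 = 1 \<and> P = param_curve a b [:0, 1:])"

end

theory Submission
  imports Defs
begin

text \<open>
  An affine line on the Pell surface is parametrized by \<open>x, y, u \<in> k[t]\<close> with
  \<open>x\<^sup>2 - g(u) y\<^sup>2 = 1\<close>. Suppose that \<open>u\<close> is constant and not a root
  of \<open>g\<close>. If \<open>x, y\<close> were not constant, the leading coefficients would show that \<open>g(u) = e\<^sup>2\<close> in \<open>k\<close>,
  and then \<open>x \<plusminus> e y\<close> are units of \<open>k[t]\<close>, hence constant, a contradiction. If \<open>u\<close> has degree
  \<open>m > 0\<close>, expand \<open>x = \<Sum> x\<^sub>i(u) t\<^sup>i\<close> and \<open>y = \<Sum> y\<^sub>i(u) t\<^sup>i\<close> with \<open>i < m\<close>. Let \<open>s\<close> be the square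
  root of \<open>g\<close> among the Laurent series in \<open>1/u\<close>. One of \<open>x \<plusminus> s(u) y\<close> has degree \<open>n = deg x\<close> and the
  other \<open>-n\<close>. Since the summands have degrees that are distinct modulo \<open>m\<close>, no cancellation
  occurs, and multiplying the bounds for \<open>x\<^sub>i \<plusminus> s y\<^sub>i\<close> gives \<open>m deg (x\<^sub>i\<^sup>2 - g y\<^sub>i\<^sup>2) \<le> -2 i\<close>. So
  \<open>x\<^sub>i\<^sup>2 = g y\<^sub>i\<^sup>2\<close> for \<open>i > 0\<close>, whence \<open>x\<^sub>i = y\<^sub>i = 0\<close> unless \<open>g\<close> is a square,
  and for a square \<open>g\<close> the unit argument applies again. Thus \<open>x, y \<in> k[u]\<close> and the curve is a section.
\<close>

section \<open>The Pell equation over a polynomial ring\<close>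

lemma two_neq_zero:
  assumes "CHAR('k::field) \<noteq> 2" shows "(2::'k) \<noteq> 0"
proof
  assume "(2::'k) = 0"
  hence "CHAR('k) dvd 2" using of_nat_eq_0_iff_char_dvd[where 'a='k, of 2] by simp
  moreover have "CHAR('k) \<noteq> 1" by simp
  ultimately show False using assms
    by (metis prime_nat_iff two_is_prime_nat)
qed

section \<open>Truncated square roots of polynomials\<close>

text \<open>Completing the square from the top coefficient downwards. Up to sign, \<open>S\<close>
  is the polynomial part of the square root of \<open>f\<close> in Laurent series in the inverse of
  the variable.\<close>

lemma poly_approx_sqrt:
  fixes f :: "'k::field poly"
  assumes "(2::'k) \<noteq> 0" "D > 0" "Polynomial.degree f = 2 * D" "Polynomial.lead_coeff f = a ^ 2"
  shows "\<exists>S. Polynomial.degree S = D \<and> Polynomial.degree (f - S ^ 2) < D"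
proof -
  have "f \<noteq> 0" using assms(2,3) by auto
  then have a: "a \<noteq> 0" using assms(4) by auto
  have "\<exists>S. Polynomial.degree S = D \<and> Polynomial.lead_coeff S = a \<and>
      Polynomial.degree (f - S ^ 2) < 2 * D - j" if "j \<le> D" for j
    using that
  proof (induction j)
    case 0
    let ?S = "Polynomial.monom a D"
    have deg: "Polynomial.degree ?S = D" using a by (simp add: Polynomial.degree_monom_eq)
    have "Polynomial.degree (f - ?S ^ 2) < 2 * D"
    proof (rule degree_lessI)
      show "f - ?S ^ 2 \<noteq> 0 \<or> 0 < 2 * D" using assms by simp
      show "\<forall>k\<ge>2 * D. Polynomial.coeff (f - ?S ^ 2) k = 0"
        using assms by (auto simp: monom_power Polynomial.coeff_eq_0 mult.commute)
    qed
    then show ?case using deg by (intro exI[of _ ?S]) simp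
  next
    case (Suc j)
    then obtain S where S: "Polynomial.degree S = D" "Polynomial.lead_coeff S = a"
      "Polynomial.degree (f - S ^ 2) < 2 * D - j" by auto
    \<comment> \<open>The next coefficient of \<open>f - S ^ 2\<close> to remove sits at
      \<open>D + e\<close>. Adding a monomial \<open>c\<close> of degree \<open>e\<close> to
      \<open>S\<close> changes it by \<open>- 2 * a * c\<close>, which dictates \<open>c\<close>;
      since \<open>e < D\<close>, the square of the monomial has degree below
      \<open>D + e\<close>.\<close>
    define e where "e = D - j - 1"
    have e: "2 * D - Suc j = D + e" "e < D" using Suc.prems by (auto simp: e_def)
    define c where "c = Polynomial.coeff (f - S ^ 2) (D + e) / (2 * a)"
    let ?m = "Polynomial.monom c e"
    have dm: "Polynomial.degree ?m \<le> e" by (rule Polynomial.degree_monom_le)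
    have dS: "Polynomial.degree (S + ?m) = D" using dm e S
      by (simp add: degree_add_eq_left)
    have cS: "Polynomial.coeff ?m D = 0" using e by simp
    have eq: "f - (S + ?m) ^ 2 = (f - S ^ 2) - (Polynomial.monom (2 * c) e * S + Polynomial.monom (c ^ 2) (2 * e))"
    proof -
      have double: "Polynomial.monom (2 * c) e = 2 * ?m" by (metis add_monom mult_2)
      have square: "Polynomial.monom (c ^ 2) (2 * e) = ?m ^ 2" by (simp add: monom_power mult.commute)
      show ?thesis unfolding double square by (simp add: power2_eq_square algebra_simps)
    qed
    have "Polynomial.degree (f - (S + ?m) ^ 2) < D + e"
    proof (rule degree_lessI)
      show "f - (S + ?m) ^ 2 \<noteq> 0 \<or> 0 < D + e" using assms by simp
      show "\<forall>k\<ge>D + e. Polynomial.coeff (f - (S + ?m) ^ 2) k = 0"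
      proof (intro allI impI)
        fix k assume k: "k \<ge> D + e"
        have "Polynomial.coeff (Polynomial.monom (c ^ 2) (2 * e)) k = 0" using k e by simp
        moreover have "Polynomial.coeff (Polynomial.monom (2 * c) e * S) k = 2 * c * Polynomial.coeff S (k - e)"
          using k by (simp add: Polynomial.coeff_monom_mult)
        ultimately have *: "Polynomial.coeff (f - (S + ?m) ^ 2) k =
            Polynomial.coeff (f - S ^ 2) k - 2 * c * Polynomial.coeff S (k - e)"
          unfolding eq by simp
        show "Polynomial.coeff (f - (S + ?m) ^ 2) k = 0"
        proof (cases "k = D + e")
          case True
          then show ?thesis unfolding * using S(1,2) a assms(1) by (simp add: c_def)
        next
          case False
          then have "k > Polynomial.degree (f - S ^ 2)" "k - e > Polynomial.degree S"
            using k S e by linarith+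
          then have "Polynomial.coeff (f - S ^ 2) k = 0" "Polynomial.coeff S (k - e) = 0"
            by (simp_all only: Polynomial.coeff_eq_0)
          then show ?thesis unfolding * by simp
        qed
      qed
    qed
    then show ?case using dS e(1) S cS by (intro exI[of _ "S + ?m"]) simp
  qed
  from this[of D] show ?thesis by (auto simp: mult_2)
qed

section \<open>Coordinates of k[t] over the subring k[u]\<close>

lemma degree_div_plus_degree:
  fixes p u :: "'k::field poly"
  assumes "p div u \<noteq> 0"
  shows "Polynomial.degree p = Polynomial.degree u + Polynomial.degree (p div u)"
proof -
  have u: "u \<noteq> 0" using assms by auto
  have "Polynomial.degree p = Polynomial.degree (u * (p div u) + p mod u)" by simp
  also have "\<dots> = Polynomial.degree (u * (p div u))"
  proof (cases "p mod u = 0")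
    case False
    then have "Polynomial.degree (p mod u) < Polynomial.degree u"
      using degree_mod_less[OF u, of p] by simp
    then show ?thesis using assms u
      by (intro degree_add_eq_left) (simp add: Polynomial.degree_mult_eq)
  qed simp
  finally show ?thesis using assms u by (simp add: Polynomial.degree_mult_eq)
qed

text \<open>
  If \<open>u\<close> has degree \<open>m > 0\<close>, then \<open>1, t, \<dots>, t ^ (m - 1)\<close> is a basis of \<open>k[t]\<close> over \<open>k[u]\<close>.
  The \<open>i\<close>-th coordinate of \<open>p\<close> is read off the \<open>u\<close>-adic expansion of \<open>p\<close>.
\<close>

function power_coord :: "'k::field poly \<Rightarrow> nat \<Rightarrow> 'k poly \<Rightarrow> 'k poly" where
  "power_coord u i p = (if p = 0 \<or> Polynomial.degree u = 0 then 0
     else pCons (Polynomial.coeff (p mod u) i) (power_coord u i (p div u)))"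
  by auto
termination
\<comment> \<open>The measure separates 0 from the nonzero constants: both have degree 0, but a
  nonzero constant still takes one division step to reach 0.\<close>
proof (relation "measure (\<lambda>(u, i, p). if p = 0 then 0 else Suc (Polynomial.degree p))", goal_cases)
  case (2 u i p)
  then show ?case using degree_div_plus_degree[of p u] by auto
qed auto

declare power_coord.simps [simp del]

context
  fixes u :: "'k::field poly"
  assumes u: "Polynomial.degree u > 0"
begin

lemma poly_div_induct [case_names 0 div]:
  assumes "P 0" "\<And>p. p \<noteq> 0 \<Longrightarrow> P (p div u) \<Longrightarrow> P p"
  shows "P p"
proof (induction "if p = 0 then 0 else Suc (Polynomial.degree p)" arbitrary: p rule: less_induct)
  case less
  show ?case
  proof (cases "p = 0")
    case False
    show ?thesis
      by (rule assms(2)[OF False less]) (use False u degree_div_plus_degree[of p u] in auto)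
  qed (simp add: assms)
qed

lemma power_coord_0 [simp]: "power_coord u i 0 = 0"
  by (simp add: power_coord.simps)

lemma power_coord_rec:
  "power_coord u i p = pCons (Polynomial.coeff (p mod u) i) (power_coord u i (p div u))"
  using u by (cases "p = 0") (simp_all add: power_coord.simps[of u i p])

lemma power_coord_add: "power_coord u i (p + q) = power_coord u i p + power_coord u i q"
proof (induction p arbitrary: q rule: poly_div_induct)
  case (div p)
  have "power_coord u i (p + q) = pCons (Polynomial.coeff ((p + q) mod u) i) (power_coord u i ((p + q) div u))"
    by (rule power_coord_rec)
  also have "\<dots> = power_coord u i p + power_coord u i q"
    by (simp add: power_coord_rec[of _ p] power_coord_rec[of _ q] div poly_mod_add_left poly_div_add_left)
  finally show ?case .
qed simp

lemma power_coord_smult: "power_coord u i (Polynomial.smult c p) = Polynomial.smult c (power_coord u i p)"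
proof (induction p rule: poly_div_induct)
  case (div p)
  have "power_coord u i (Polynomial.smult c p) = pCons (Polynomial.coeff (Polynomial.smult c p mod u) i)
      (power_coord u i (Polynomial.smult c p div u))"
    by (rule power_coord_rec)
  also have "\<dots> = Polynomial.smult c (power_coord u i p)"
    by (simp add: power_coord_rec[of _ p] div mod_smult_left div_smult_left)
  finally show ?case .
qed simp

lemma power_coord_diff: "power_coord u i (p - q) = power_coord u i p - power_coord u i q"
  using power_coord_add[of i p "Polynomial.smult (-1) q"] power_coord_smult[of i "-1" q] by simp

lemma power_coord_mult_base: "power_coord u i (u * p) = pCons 0 (power_coord u i p)"
proof -
  have "u \<noteq> 0" using u by auto
  then show ?thesis by (simp add: power_coord_rec[of _ "u * p"])
qed

text \<open>Linearity over k[u], obtained by a Horner induction on \<open>w\<close> from additivity,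
  scalars and multiplication by \<open>u\<close>.\<close>

lemma power_coord_mult_pcompose: "power_coord u i ((w \<circ>\<^sub>p u) * p) = w * power_coord u i p"
proof (induction w)
  case (pCons c w)
  have "(pCons c w \<circ>\<^sub>p u) * p = Polynomial.smult c p + u * ((w \<circ>\<^sub>p u) * p)"
    by (simp add: pcompose_pCons algebra_simps)
  then show ?case
    by (simp add: power_coord_add power_coord_smult power_coord_mult_base pCons)
qed simp

text \<open>With m the degree of \<open>u\<close>, the summands p_i(u) t^i of \<open>p\<close> with
  i < m have degrees distinct modulo m, so none can cancel and each has degree at most that of
  \<open>p\<close>.\<close>

lemma degree_power_coord_le:
  assumes "power_coord u i p \<noteq> 0"
  shows "Polynomial.degree u * Polynomial.degree (power_coord u i p) + i \<le> Polynomial.degree p"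
  using assms
proof (induction p rule: poly_div_induct)
  case (div p)
  show ?case
  proof (cases "power_coord u i (p div u) = 0")
    case False
    then have "p div u \<noteq> 0" by auto
    then show ?thesis
      using div(2)[OF False] False degree_div_plus_degree[of p u]
      by (simp add: power_coord_rec[of _ p])
  next
    case True
    then have c: "Polynomial.coeff (p mod u) i \<noteq> 0" 
      using div(3) by (simp add: power_coord_rec[of _ p])
    then have "i \<le> Polynomial.degree (p mod u)" by (rule Polynomial.le_degree)
    also have "\<dots> \<le> Polynomial.degree p"
    proof (cases "p div u = 0")
      case True
      then have "p mod u = p" by (metis add_0 mult_zero_left div_mult_mod_eq)
      then show ?thesis by simp
    next
      case False
      then show ?thesis using degree_div_plus_degree[of p u] u degree_mod_less[of u p] by force
    qed
    finally show ?thesis using True by (simp add: power_coord_rec[of _ p])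
  qed
qed simp

lemma eq_pcompose_power_coord:
  assumes "\<And>i. i > 0 \<Longrightarrow> power_coord u i p = 0"
  shows "p = power_coord u 0 p \<circ>\<^sub>p u"
  using assms
proof (induction p rule: poly_div_induct)
  case (div p)
  have z: "Polynomial.coeff (p mod u) i = 0 \<and> power_coord u i (p div u) = 0" if "i > 0" for i
    using div(3)[OF that] by (simp add: power_coord_rec[of _ p])
  then have "p mod u = [:Polynomial.coeff (p mod u) 0:]"
    by (intro poly_eqI) (simp add: coeff_pCons split: nat.split)
  moreover have "p = p mod u + u * (p div u)" by simp
  ultimately have "p = [:Polynomial.coeff (p mod u) 0:] + u * (power_coord u 0 (p div u) \<circ>\<^sub>p u)"
    using div(2) z by metis
  then show ?case by (simp add: power_coord_rec[of _ p] pcompose_pCons)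
qed simp

end

section \<open>Pell equations with square or constant coefficient\<close>

text \<open>Descent on the denominator of a square root s = p/q of \<open>f\<close>. If the
  remainder \<open>r = p - h * q\<close> is nonzero, then (f q - h p) / r is again s, because s^2 -
  h s = s (s - h), and \<open>r\<close> has smaller degree than \<open>q\<close>.\<close>

lemma square_of_square_quotient:
  fixes f p q :: "'k::field poly"
  assumes "p ^ 2 = f * q ^ 2" "q \<noteq> 0"
  shows "\<exists>h. f = h ^ 2"
  using assms
proof (induction "Polynomial.degree q" arbitrary: p q rule: less_induct)
  case less
  define h r where "h = p div q" and "r = p mod q"
  have p: "p = h * q + r" by (simp add: h_def r_def)
  show ?case
  proof (cases "r = 0")
    case True
    then have "f * q ^ 2 = h ^ 2 * q ^ 2"
      using p less.prems(1) by (metis add_0_right power_mult_distrib)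
    then have "f = h ^ 2" using less.prems(2) by (metis mult_right_cancel power_not_zero)
    then show ?thesis ..
  next
    case False
    have "Polynomial.degree r < Polynomial.degree q"
      using degree_mod_less[of q p] False less.prems(2) by (auto simp: r_def)
    moreover have "(f * q - h * p) ^ 2 = f * r ^ 2"
    proof -
      have r: "r = p - h * q" using p by simp
      have "(f * q - h * p) ^ 2 = f * (f * q ^ 2) - 2 * f * q * h * p + h ^ 2 * p ^ 2"
        by (simp add: power2_eq_square algebra_simps)
      also have "\<dots> = f * p ^ 2 - 2 * f * q * h * p + h ^ 2 * (f * q ^ 2)"
        using less.prems(1) by simp
      also have "\<dots> = f * r ^ 2" unfolding r by (simp add: power2_eq_square algebra_simps)
      finally show ?thesis .
    qed
    ultimately show ?thesis using less.hyps False by blast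
  qed
qed

text \<open>The factors \<open>x - h * y\<close> and \<open>x + h * y\<close> are inverse units of
  k[t], hence constant; so are their sum \<open>2 * x\<close> and difference
  \<open>2 * h * y\<close>.\<close>

lemma pell_square_const:
  fixes x y h :: "'k::field poly"
  assumes "(2::'k) \<noteq> 0" "x ^ 2 - h ^ 2 * y ^ 2 = 1" "h \<noteq> 0"
  shows "Polynomial.degree x = 0" "Polynomial.degree y = 0"
proof -
  have "(x - h * y) * (x + h * y) = 1" using assms(2) by (simp add: power2_eq_square algebra_simps)
  then have "is_unit (x - h * y)" "is_unit (x + h * y)" by (metis dvd_triv_left, metis dvd_triv_right)
  then have *: "Polynomial.degree (x - h * y) = 0" "Polynomial.degree (x + h * y) = 0"
    using is_unit_iff_degree by (metis not_is_unit_0)+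
  have "Polynomial.degree ((x + h * y) + (x - h * y)) = 0"
    using Polynomial.degree_add_le[of "x + h * y" 0 "x - h * y"] * by simp
  moreover have "(x + h * y) + (x - h * y) = Polynomial.smult 2 x"
    by (simp add: numeral_poly)
  ultimately show "Polynomial.degree x = 0" using assms(1) by simp
  have "Polynomial.degree ((x + h * y) - (x - h * y)) = 0"
    using Polynomial.degree_diff_le[of "x + h * y" 0 "x - h * y"] * by simp
  moreover have "(x + h * y) - (x - h * y) = Polynomial.smult 2 (h * y)"
    by (simp add: numeral_poly)
  ultimately have "Polynomial.degree (h * y) = 0" using assms(1) by simp
  then show "Polynomial.degree y = 0" using assms(3) by (cases "y = 0") (auto simp: Polynomial.degree_mult_eq)
qed

text \<open>If \<open>y\<close> is not constant, the leading coefficients in x^2 = 1 + d y^2 exhibit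
  \<open>d\<close> as a square in k, and \<open>pell_square_const\<close> applies.\<close>

lemma pell_const:
  fixes x y :: "'k::field poly"
  assumes "(2::'k) \<noteq> 0" "x ^ 2 - Polynomial.smult d (y ^ 2) = 1" "d \<noteq> 0"
  shows "Polynomial.degree x = 0 \<and> Polynomial.degree y = 0"
proof (cases "Polynomial.degree y = 0")
  case True
  then obtain b where "y = [:b:]" by (auto elim: degree_eq_zeroE)
  then have "x ^ 2 = [:1 + d * b ^ 2:]" using assms(2)
    by (simp add: algebra_simps power2_eq_square one_pCons)
  then have "2 * Polynomial.degree x = 0" by (metis degree_power_eq degree_pCons_0 degree_0 mult_0_right)
  then show ?thesis using True by simp
next
  case False
  then have y: "y \<noteq> 0" by auto
  have x: "x ^ 2 = 1 + Polynomial.smult d (y ^ 2)" using assms(2) by (simp add: algebra_simps)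
  have "Polynomial.lead_coeff (x ^ 2) = d * Polynomial.lead_coeff y ^ 2"
    unfolding x using False y assms(3)
    by (subst lead_coeff_add_le) (simp add: degree_power_eq, simp only: lead_coeff_smult Polynomial.lead_coeff_power)
  then have "d = (Polynomial.lead_coeff x / Polynomial.lead_coeff y) ^ 2"
    using y by (simp add: Polynomial.lead_coeff_power power_divide field_simps)
  then obtain e where e: "d = e ^ 2" by blast
  have "x ^ 2 - [:e:] ^ 2 * y ^ 2 = 1" using assms(2) e by (simp add: power2_eq_square)
  then show ?thesis using pell_square_const[of x "[:e:]" y] assms e by auto
qed

lemma pcompose_power:
  fixes p q :: "'k::field poly"
  shows "(p ^ n) \<circ>\<^sub>p q = (p \<circ>\<^sub>p q) ^ n"
  by (induction n) (simp_all add: pcompose_mult pcompose_1)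

section \<open>Descent of Pell solutions from k[t] to k[u]\<close>

lemma pell_descends:
  fixes x y g u :: "'k::field poly"
  assumes two: "(2::'k) \<noteq> 0" and pell: "x ^ 2 - (g \<circ>\<^sub>p u) * y ^ 2 = 1"
    and g: "g \<noteq> 0" "even (Polynomial.degree g)" and u: "Polynomial.degree u > 0"
  obtains v w where "x = v \<circ>\<^sub>p u" "y = w \<circ>\<^sub>p u"
proof -
  consider (const) "Polynomial.degree x = 0 \<and> Polynomial.degree y = 0"
    | (square) h where "g = h ^ 2"
    | (main) "y \<noteq> 0" "Polynomial.degree g > 0" "\<And>h. g \<noteq> h ^ 2"
  proof (cases "y = 0 \<or> Polynomial.degree g = 0")
    case True
    then show ?thesis
    proof
      assume "y = 0"
      then have "Polynomial.degree (x ^ 2) = 0" using pell by simp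
      then have "Polynomial.degree x = 0" by (cases "x = 0") (simp_all add: degree_power_eq)
      then show ?thesis using \<open>y = 0\<close> const by simp
    next
      assume "Polynomial.degree g = 0"
      then obtain c where c: "g = [:c:]" by (auto elim: degree_eq_zeroE)
      then show ?thesis using const pell_const[OF two, of x c y] pell g by simp
    qed
  qed (use that in blast)
  then show thesis
  proof cases
    case const
    then obtain a b where "x = [:a:]" "y = [:b:]" by (metis degree_eq_zeroE)
    then show ?thesis using that[of "[:a:]" "[:b:]"] by simp
  next
    case square
    then have "h \<circ>\<^sub>p u \<noteq> 0" using g u by (auto simp: pcompose_eq_0)
    moreover have "x ^ 2 - (h \<circ>\<^sub>p u) ^ 2 * y ^ 2 = 1"
      using pell square by (simp add: power2_eq_square pcompose_mult)
    ultimately have "Polynomial.degree x = 0" "Polynomial.degree y = 0"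
      using pell_square_const[OF two] by blast+
    then obtain a b where "x = [:a:]" "y = [:b:]" by (metis degree_eq_zeroE)
    then show ?thesis using that[of "[:a:]" "[:b:]"] by simp
  next
    case main
    define m where "m = Polynomial.degree u"
    define n where "n = Polynomial.degree x"
    obtain d where d: "Polynomial.degree g = 2 * d" using g(2) by blast
    have m0: "m > 0" and d0: "d > 0" using u main(2) d by (auto simp: m_def)
    have md: "m * d > 0" using m0 d0 by simp
    let ?G = "g \<circ>\<^sub>p u"
    have G0: "?G \<noteq> 0" using g u by (auto simp: pcompose_eq_0)
    have degG: "Polynomial.degree ?G = 2 * (m * d)" by (simp add: degree_pcompose d m_def)
    have x2: "x ^ 2 = 1 + ?G * y ^ 2" using pell by (simp add: algebra_simps)
    have degGy: "Polynomial.degree (?G * y ^ 2) = 2 * (m * d) + 2 * Polynomial.degree y"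
      using G0 main(1) by (simp add: Polynomial.degree_mult_eq degree_power_eq degG)
    have lt: "Polynomial.degree 1 < Polynomial.degree (?G * y ^ 2)" using degGy md by simp
    have "Polynomial.degree (x ^ 2) = 2 * (m * d) + 2 * Polynomial.degree y"
      unfolding x2 using degGy lt by (simp add: degree_add_eq_right)
    then have n: "n = m * d + Polynomial.degree y"
      by (cases "x = 0") (use md in \<open>auto simp: n_def degree_power_eq\<close>)
    have x0: "x \<noteq> 0" using n md by (auto simp: n_def)
    \<comment> \<open>As \<open>g\<close> has even degree, the leading coefficient of
      \<open>u\<close> enters with even exponent, so the leading coefficient of \<open>g\<close> is
      a square in k. This starts the square root of \<open>g\<close>.\<close>
    have "Polynomial.lead_coeff (x ^ 2) = Polynomial.lead_coeff (?G * y ^ 2)"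
      unfolding x2 using lt by (rule lead_coeff_add_le)
    also have "\<dots> = Polynomial.lead_coeff g * Polynomial.lead_coeff u ^ (2 * d) * Polynomial.lead_coeff y ^ 2"
      using u d by (simp only: Polynomial.lead_coeff_mult Polynomial.lead_coeff_power lead_coeff_comp)
    finally have "Polynomial.lead_coeff g =
        (Polynomial.lead_coeff x / (Polynomial.lead_coeff u ^ d * Polynomial.lead_coeff y)) ^ 2"
      using u main(1) by (auto simp: Polynomial.lead_coeff_power power_divide field_simps power_mult)
    then obtain a where a: "Polynomial.lead_coeff g = a ^ 2" by blast

    text \<open>To stay within polynomials, \<open>s\<close> is replaced by an approximation \<open>S / u ^ N\<close> with large \<open>N\<close>.\<close>
    define N where "N = 2 * n"
    define f where "f = Polynomial.monom 1 (2 * N) * g"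
    have degf: "Polynomial.degree f = 2 * (N + d)"
      using g(1) by (simp add: f_def Polynomial.degree_mult_eq Polynomial.degree_monom_eq d)
    have lcf: "Polynomial.lead_coeff f = a ^ 2"
      by (simp only: f_def Polynomial.lead_coeff_mult lead_coeff_monom a mult_1_left)
    obtain S0 where S0: "Polynomial.degree S0 = N + d" "Polynomial.degree (f - S0 ^ 2) < N + d"
      using poly_approx_sqrt[OF two _ degf lcf] d0 by auto
    define E where "E = f - S0 ^ 2"
    have E: "Polynomial.degree E < N + d" using S0 by (simp add: E_def)
    define V where "V = Polynomial.monom (1::'k) N \<circ>\<^sub>p u * x"
    have degM: "Polynomial.degree (Polynomial.monom (1::'k) k \<circ>\<^sub>p u) = k * m" for k
      by (simp add: degree_pcompose Polynomial.degree_monom_eq m_def)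
    have M0: "Polynomial.monom (1::'k) k \<circ>\<^sub>p u \<noteq> 0" for k
      using u pcompose_eq_0[of "Polynomial.monom (1::'k) k" u] by auto
    have degV: "Polynomial.degree V = N * m + n"
      using M0 x0 by (simp add: V_def Polynomial.degree_mult_eq degM n_def)
    \<comment> \<open>Stated for every \<open>S\<close> with the square of \<open>S0\<close>, since
      the sign of the root is only chosen later.\<close>
    have id: "(Polynomial.monom 1 N * p) ^ 2 - (S * q) ^ 2 = Polynomial.monom 1 (2 * N) * (p ^ 2 - g * q ^ 2) + E * q ^ 2"
      if "S ^ 2 = S0 ^ 2" for S p q
    proof -
      have M: "Polynomial.monom (1::'k) N ^ 2 = Polynomial.monom 1 (2 * N)"
        by (simp add: monom_power mult.commute)
      have S: "S ^ 2 = Polynomial.monom 1 (2 * N) * g - E" using that by (simp add: E_def f_def)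
      show ?thesis unfolding power_mult_distrib M S by (simp add: algebra_simps)
    qed
    have id': "V ^ 2 - ((S \<circ>\<^sub>p u) * y) ^ 2 = Polynomial.monom 1 (2 * N) \<circ>\<^sub>p u + (E \<circ>\<^sub>p u) * y ^ 2"
      if "S ^ 2 = S0 ^ 2" for S
    proof -
      have M: "(Polynomial.monom 1 N \<circ>\<^sub>p u) ^ 2 = Polynomial.monom (1::'k) (2 * N) \<circ>\<^sub>p u"
        by (simp add: monom_power mult.commute flip: pcompose_power)
      have S: "(S \<circ>\<^sub>p u) ^ 2 = (Polynomial.monom 1 (2 * N) \<circ>\<^sub>p u) * ?G - (E \<circ>\<^sub>p u)"
        using that by (simp add: E_def f_def pcompose_mult pcompose_diff flip: pcompose_power)
      show ?thesis unfolding V_def power_mult_distrib M S x2 by (simp add: algebra_simps)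
    qed
    \<comment> \<open>Here \<open>N = 2 * n\<close> is large enough: the error has degree below N m
      + 2 n, so the power u^(2N) dominates in \<open>id'\<close>.\<close>
    have degErr: "Polynomial.degree ((E \<circ>\<^sub>p u) * y ^ 2) < 2 * N * m"
    proof -
      have "Polynomial.degree ((E \<circ>\<^sub>p u) * y ^ 2) \<le> Polynomial.degree E * m + 2 * Polynomial.degree y"
        by (rule order.trans[OF Polynomial.degree_mult_le])
          (use main(1) in \<open>simp add: degree_pcompose degree_power_eq m_def\<close>)
      also have "\<dots> < (N + d) * m + 2 * Polynomial.degree y" using E m0 by simp
      also have "\<dots> \<le> N * m + 2 * n" using n md by (simp add: algebra_simps)
      also have "\<dots> \<le> N * m + N * m" using m0 by (simp add: N_def)
      finally show ?thesis by simp
    qed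
    have degD: "Polynomial.degree (V ^ 2 - ((S \<circ>\<^sub>p u) * y) ^ 2) = 2 * N * m" if "S ^ 2 = S0 ^ 2" for S
      unfolding id'[OF that] using degErr degM[of "2 * N"] by (simp add: degree_add_eq_left)
    define Z0 where "Z0 = (S0 \<circ>\<^sub>p u) * y"
    have S00: "S0 \<noteq> 0" using S0(1) d0 by auto
    then have "S0 \<circ>\<^sub>p u \<noteq> 0" using u by (auto simp: pcompose_eq_0)
    then have degZ0: "Polynomial.degree Z0 = N * m + n"
      using main(1) by (simp add: Z0_def Polynomial.degree_mult_eq degree_pcompose S0(1) n m_def algebra_simps)
    \<comment> \<open>\<open>V\<close> and \<open>Z0\<close> both have degree N m + n, but the
      difference of their squares only has degree 2 N m, so the leading terms of the squares
      cancel.\<close>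
    have "Polynomial.lead_coeff V ^ 2 = Polynomial.lead_coeff Z0 ^ 2"
    proof -
      have "2 * N * m < 2 * (N * m + n)" using n md by simp
      then have "Polynomial.coeff (V ^ 2 - Z0 ^ 2) (2 * (N * m + n)) = 0"
        using degD[of S0] by (intro Polynomial.coeff_eq_0) (simp add: Z0_def)
      moreover have "Polynomial.coeff (V ^ 2) (2 * (N * m + n)) = Polynomial.lead_coeff V ^ 2"
        "Polynomial.coeff (Z0 ^ 2) (2 * (N * m + n)) = Polynomial.lead_coeff Z0 ^ 2"
        using Polynomial.lead_coeff_power[of V 2] Polynomial.lead_coeff_power[of Z0 2] degV degZ0 n md
        by (cases "V = 0"; cases "Z0 = 0"; simp add: degree_power_eq)+
      ultimately show ?thesis by simp
    qed
    then consider "Polynomial.lead_coeff V = Polynomial.lead_coeff Z0"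
      | "Polynomial.lead_coeff V = - Polynomial.lead_coeff Z0" by (auto simp: power2_eq_iff)
    \<comment> \<open>The sign of \<open>S\<close> is chosen so that the leading terms of
      \<open>V\<close> and \<open>Z\<close> add up. Then \<open>V + Z\<close> has degree N m + n,
      and the product leaves N m - n for \<open>V - Z\<close>.\<close>
    then obtain S where S: "S ^ 2 = S0 ^ 2" and lc: "Polynomial.lead_coeff V = Polynomial.lead_coeff ((S \<circ>\<^sub>p u) * y)"
      and degS: "Polynomial.degree ((S \<circ>\<^sub>p u) * y) = N * m + n"
    proof cases
      case 1
      then show ?thesis using that[of S0] degZ0 by (simp add: Z0_def)
    next
      case 2
      then show ?thesis using that[of "- S0"] degZ0 by (simp add: Z0_def pcompose_uminus)
    qed
    define Z where "Z = (S \<circ>\<^sub>p u) * y"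
    have VZ: "(V - Z) * (V + Z) = V ^ 2 - Z ^ 2" by (simp add: power2_eq_square algebra_simps)
    have degVZ: "Polynomial.degree ((V - Z) * (V + Z)) = 2 * N * m"
      unfolding VZ unfolding Z_def by (rule degD[OF S])
    have N0: "N > 0" using n md by (simp add: N_def)
    have prod0: "(V - Z) * (V + Z) \<noteq> 0" using degVZ N0 m0 by (metis Polynomial.degree_0 mult_is_0 not_gr0 zero_neq_numeral)
    have "Polynomial.coeff (V + Z) (N * m + n) = 2 * Polynomial.lead_coeff V"
      using lc degV degS by (simp add: Z_def)
    moreover have "V \<noteq> 0" using degV n md by auto
    ultimately have "N * m + n \<le> Polynomial.degree (V + Z)" using two by (intro Polynomial.le_degree) simp
    moreover have "Polynomial.degree (V + Z) \<le> N * m + n"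
      using degV degS by (intro Polynomial.degree_add_le) (simp_all add: Z_def)
    ultimately have degP: "Polynomial.degree (V + Z) = N * m + n" by simp
    with degVZ prod0 have degQ: "Polynomial.degree (V - Z) + n = N * m"
      by (auto simp: Polynomial.degree_mult_eq)

    have zero: "power_coord u i x = 0 \<and> power_coord u i y = 0" if "i > 0" for i
    proof -
      define p q where "p = power_coord u i x" and "q = power_coord u i y"
      let ?A = "Polynomial.monom 1 N * p - S * q" and ?B = "Polynomial.monom 1 N * p + S * q"
      have A: "?A = power_coord u i (V - Z)" and B: "?B = power_coord u i (V + Z)"
        unfolding V_def Z_def p_def q_def
        by (simp_all only: power_coord_mult_pcompose[OF u] power_coord_add[OF u] power_coord_diff[OF u])
      \<comment> \<open>Both coordinate bounds lose \<open>i\<close>, so m times the degree is at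
        most 2 N m - 2 i; strictness comes from \<open>i > 0\<close>.\<close>
      have "Polynomial.degree (?A * ?B) < 2 * N"
      proof (cases "?A = 0 \<or> ?B = 0")
        case False
        then have "m * Polynomial.degree ?A + i \<le> Polynomial.degree (V - Z)"
          "m * Polynomial.degree ?B + i \<le> Polynomial.degree (V + Z)"
          using degree_power_coord_le[OF u] unfolding A B m_def by auto
        then have "m * (Polynomial.degree ?A + Polynomial.degree ?B) < m * (2 * N)"
          using degP degQ that by (simp add: algebra_simps)
        then show ?thesis using False by (simp add: Polynomial.degree_mult_eq)
      qed (use N0 in auto)
      moreover have "Polynomial.degree (E * q ^ 2) < 2 * N"
      proof (cases "q = 0")
        case False
        have "Polynomial.degree q \<le> m * Polynomial.degree q" using m0 by simp
        also have "\<dots> \<le> Polynomial.degree y"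
          using degree_power_coord_le[OF u, of i y] False by (simp add: q_def m_def)
        finally have "Polynomial.degree q \<le> Polynomial.degree y" .
        moreover have "d \<le> m * d" using m0 by simp
        moreover have "Polynomial.degree (E * q ^ 2) \<le> Polynomial.degree E + 2 * Polynomial.degree q"
          by (rule order.trans[OF Polynomial.degree_mult_le]) (use False in \<open>simp add: degree_power_eq\<close>)
        ultimately show ?thesis using E n unfolding N_def by linarith
      qed (use N0 in auto)
      moreover have "Polynomial.monom 1 (2 * N) * (p ^ 2 - g * q ^ 2) = ?A * ?B - E * q ^ 2"
        using id[OF S, of p q] by (simp add: power2_eq_square algebra_simps)
      ultimately have "Polynomial.degree (Polynomial.monom 1 (2 * N) * (p ^ 2 - g * q ^ 2)) < 2 * N"
        by (metis degree_diff_less)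
      \<comment> \<open>A nonzero multiple of a monomial of degree \<open>2 * N\<close> cannot have
        degree below \<open>2 * N\<close>.\<close>
      then have "p ^ 2 - g * q ^ 2 = 0"
        by (cases "p ^ 2 - g * q ^ 2 = 0") (simp_all add: Polynomial.degree_mult_eq Polynomial.degree_monom_eq)
      then have "p ^ 2 = g * q ^ 2" by simp
      then have "q = 0" using square_of_square_quotient main(3) by blast
      with \<open>p ^ 2 = g * q ^ 2\<close> show ?thesis by (simp add: p_def q_def)
    qed
    show ?thesis
      using that eq_pcompose_power_coord[OF u, of x] eq_pcompose_power_coord[OF u, of y] zero by metis
  qed
qed

section \<open>Parametrization of affine lines\<close>

context domain
begin

text \<open>The explicit set of representatives of \<open>a\<close> as a fraction. It allows the
  unions in the operations of \<open>frac_field\<close> to be evaluated directly on embedded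
  elements.\<close>

lemma frac_class_mult_self:
  assumes "a \<in> carrier R" "d \<in> carrier R - {\<zero>}"
  shows "frac_class R (a \<otimes> d) d = (\<lambda>e. (a \<otimes> e, e)) ` (carrier R - {\<zero>})"
proof -
  have "(a \<otimes> d) \<otimes> e = c \<otimes> d \<longleftrightarrow> c = a \<otimes> e" if "c \<in> carrier R" "e \<in> carrier R" for c e
  proof -
    have "(a \<otimes> d) \<otimes> e = (a \<otimes> e) \<otimes> d" using assms that by (simp add: m_ac)
    then show ?thesis using assms that m_rcancel[of d "a \<otimes> e" c] by auto
  qed
  then show ?thesis using assms by (auto simp: frac_class_def frac_rel_def)
qed

lemma frac_embed_eq:
  assumes "a \<in> carrier R"
  shows "frac_embed R a = (\<lambda>e. (a \<otimes> e, e)) ` (carrier R - {\<zero>})"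
  using frac_class_mult_self[of a \<one>] assms by (simp add: frac_embed_def)

lemma frac_class_eq_embed:
  assumes "a \<in> carrier R" "d \<in> carrier R - {\<zero>}"
  shows "frac_class R (a \<otimes> d) d = frac_embed R a"
  using assms by (simp add: frac_class_mult_self frac_embed_eq)

lemma frac_embed_closed: "a \<in> carrier R \<Longrightarrow> frac_embed R a \<in> carrier (frac_field R)"
  by (auto simp: frac_field_def frac_embed_def frac_class_def intro!: quotientI)

lemma inj_on_frac_embed: "inj_on (frac_embed R) (carrier R)"
proof (rule inj_onI)
  fix a b assume ab: "a \<in> carrier R" "b \<in> carrier R" "frac_embed R a = frac_embed R b"
  have "(a \<otimes> \<one>, \<one>) \<in> frac_embed R a" 
    unfolding frac_embed_eq[OF ab(1)] by (rule image_eqI[of _ _ \<one>]) auto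
  then have "(a \<otimes> \<one>, \<one>) \<in> frac_embed R b" using ab(3) by simp
  then show "a = b" using ab(1,2) by (auto simp: frac_embed_eq)
qed

lemma frac_embed_mult:
  assumes "a \<in> carrier R" "b \<in> carrier R"
  shows "frac_embed R a \<otimes>\<^bsub>frac_field R\<^esub> frac_embed R b = frac_embed R (a \<otimes> b)"
proof -
  have "frac_class R (a \<otimes> d \<otimes> (b \<otimes> e)) (d \<otimes> e) = frac_embed R (a \<otimes> b)"
    if "d \<in> carrier R - {\<zero>}" "e \<in> carrier R - {\<zero>}" for d e
  proof -
    have "a \<otimes> d \<otimes> (b \<otimes> e) = (a \<otimes> b) \<otimes> (d \<otimes> e)" using assms that by (simp add: m_ac)
    then show ?thesis using assms that by (simp add: frac_class_eq_embed integral_iff)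
  qed
  \<comment> \<open>All representatives give the same class, so the union collapses to it once the
    index set is nonempty.\<close>
  moreover have "carrier R - {\<zero>} \<noteq> {}" using one_closed one_not_zero by blast
  ultimately show ?thesis using assms
    by (simp add: frac_field_def frac_embed_eq[of a] frac_embed_eq[of b])
qed

lemma frac_embed_add:
  assumes "a \<in> carrier R" "b \<in> carrier R"
  shows "frac_embed R a \<oplus>\<^bsub>frac_field R\<^esub> frac_embed R b = frac_embed R (a \<oplus> b)"
proof -
  have "frac_class R (a \<otimes> d \<otimes> e \<oplus> b \<otimes> e \<otimes> d) (d \<otimes> e) = frac_embed R (a \<oplus> b)"
    if "d \<in> carrier R - {\<zero>}" "e \<in> carrier R - {\<zero>}" for d e
  proof -
    have "a \<otimes> d \<otimes> e \<oplus> b \<otimes> e \<otimes> d = (a \<oplus> b) \<otimes> (d \<otimes> e)"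
      using assms that by (simp add: m_ac l_distr r_distr)
    then show ?thesis using assms that by (simp add: frac_class_eq_embed integral_iff)
  qed
  moreover have "carrier R - {\<zero>} \<noteq> {}" using one_closed one_not_zero by blast
  ultimately show ?thesis using assms
    by (simp add: frac_field_def frac_embed_eq[of a] frac_embed_eq[of b])
qed

lemma frac_field_one: "\<one>\<^bsub>frac_field R\<^esub> = frac_embed R \<one>"
  by (simp add: frac_field_def frac_embed_def)

lemma frac_field_zero: "\<zero>\<^bsub>frac_field R\<^esub> = frac_embed R \<zero>"
  by (simp add: frac_field_def frac_embed_def)

text \<open>Evaluated from the definition of the sum as a fold, by existence and uniqueness of the
  fold value, since the abelian monoid laws of \<open>frac_field R\<close> are not established
  here.\<close>

lemma frac_field_finsum_singleton:
  assumes "a \<in> carrier R" "f i = frac_embed R a"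
  shows "finsum (frac_field R) f {i} = frac_embed R a"
proof -
  let ?D = "carrier (frac_field R)" and ?g = "add (frac_field R) \<circ> f"
  let ?z = "\<zero>\<^bsub>frac_field R\<^esub>"
  have g: "?g i ?z = frac_embed R a" using assms by (simp add: frac_field_zero frac_embed_add)
  have empty: "({}, ?z) \<in> foldSetD ?D ?g ?z"
    by (rule foldSetD.emptyI) (simp add: frac_field_zero frac_embed_closed)
  have "({i}, ?g i ?z) \<in> foldSetD ?D ?g ?z"
    by (rule foldSetD.insertI[OF _ _ empty]) (use assms in \<open>simp_all only: g frac_embed_closed\<close>, simp)
  moreover have "w = ?g i ?z" if w: "({i}, w) \<in> foldSetD ?D ?g ?z" for w
  proof -
    obtain j y where "j \<in> {i}" "({i} - {j}, y) \<in> foldSetD ?D ?g ?z" "w = ?g j y"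
      using foldSetD_backwards[OF _ w] by auto
    then show ?thesis by (auto elim: foldSetD.cases)
  qed
  ultimately have "foldD ?D ?g ?z {i} = ?g i ?z"
    unfolding foldD_def by (rule the_equality)
  then show ?thesis using g by (simp add: finsum_def finprod_def)
qed

text \<open>\<open>a\<close> is integral as a root of the monic polynomial X - a, so n = 1 and the
  only coefficient is \<open>\<ominus> a\<close>.\<close>

lemma frac_embed_in_normalization:
  assumes "a \<in> carrier R"
  shows "frac_embed R a \<in> carrier (normalization R)"
proof -
  let ?F = "frac_field R" and ?c = "\<lambda>_. frac_embed R (\<ominus> a)"
  have nat_pow: "frac_embed R a [^]\<^bsub>?F\<^esub> (0::nat) = frac_embed R \<one>"
    "frac_embed R a [^]\<^bsub>?F\<^esub> (1::nat) = frac_embed R a"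
    using assms by (simp_all add: nat_pow_def frac_field_one frac_embed_mult)
  have "(\<Oplus>\<^bsub>?F\<^esub>i\<in>{0::nat}. ?c i \<otimes>\<^bsub>?F\<^esub> frac_embed R a [^]\<^bsub>?F\<^esub> i) = frac_embed R (\<ominus> a)"
    using assms by (intro frac_field_finsum_singleton) (simp_all add: nat_pow frac_embed_mult frac_field_one)
  moreover have "{..<1::nat} = {0}" by auto
  ultimately have "frac_embed R a [^]\<^bsub>?F\<^esub> (1::nat) \<oplus>\<^bsub>?F\<^esub>
      (\<Oplus>\<^bsub>?F\<^esub>i\<in>{..<1::nat}. ?c i \<otimes>\<^bsub>?F\<^esub> frac_embed R a [^]\<^bsub>?F\<^esub> i) = \<zero>\<^bsub>?F\<^esub>"
    using assms by (simp only: nat_pow frac_embed_add a_inv_closed r_neg frac_field_zero)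
  then have "integral_elem ?F (frac_embed R ` carrier R) (frac_embed R a)"
    using assms unfolding integral_elem_def
    by (intro conjI exI[of _ "1::nat"] exI[of _ ?c]) (auto simp: frac_embed_closed)
  then show ?thesis by (simp add: normalization_def)
qed

lemma frac_embed_ring_hom: "frac_embed R \<in> ring_hom R (normalization R)"
proof -
  have "monoid.mult (normalization R) = monoid.mult (frac_field R)"
    "add (normalization R) = add (frac_field R)" "one (normalization R) = one (frac_field R)"
    by (simp_all add: normalization_def)
  then show ?thesis
    by (intro ring_hom_memI)
      (simp_all add: frac_embed_in_normalization frac_embed_mult frac_embed_add frac_field_one)
qed

end

section \<open>Substitution homomorphisms from k[x,y,u] to k[t]\<close>

lemma subst3_0 [simp]: "subst3 a b c 0 = 0"
  by (simp add: subst3_def)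

lemma subst3_pCons:
  "subst3 a b c (pCons G F) = poly (map_poly (\<lambda>h. h \<circ>\<^sub>p c) G) b + a * subst3 a b c F"
  by (simp add: subst3_def map_poly_pCons)

lemma subst3_pcompose:
  "subst3 (a \<circ>\<^sub>p p) (b \<circ>\<^sub>p p) (c \<circ>\<^sub>p p) F = subst3 a b c F \<circ>\<^sub>p p"
proof (induction F)
  case (pCons G F)
  have "poly (map_poly (\<lambda>h. h \<circ>\<^sub>p (c \<circ>\<^sub>p p)) G) (b \<circ>\<^sub>p p) = poly (map_poly (\<lambda>h. h \<circ>\<^sub>p c) G) b \<circ>\<^sub>p p"
    by (induction G) (simp_all add: map_poly_pCons pcompose_add pcompose_mult pcompose_assoc)
  then show ?case by (simp add: subst3_pCons pcompose_add pcompose_mult pCons)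
qed simp

text \<open>Substituting a nonconstant \<open>p\<close> for t is injective on k[t], so
  reparametrizing does not change the kernel.\<close>

lemma param_curve_pcompose:
  assumes "Polynomial.degree p > 0"
  shows "param_curve (a \<circ>\<^sub>p p) (b \<circ>\<^sub>p p) (c \<circ>\<^sub>p p) = param_curve a b c"
  using assms by (auto simp: param_curve_def subst3_pcompose dest: pcompose_eq_0)

text \<open>A k-algebra homomorphism is determined by the images of the variables. There is one
  induction per polynomial layer, starting with the innermost variable u.\<close>

lemma ring_hom_eq_subst3:
  fixes \<phi> :: "'k::field poly3 \<Rightarrow> 'k poly"
  assumes add: "\<And>F G. \<phi> (F + G) = \<phi> F + \<phi> G" and mult: "\<And>F G. \<phi> (F * G) = \<phi> F * \<phi> G"
    and const: "\<And>c. \<phi> (const3 c) = [:c:]"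
  shows "\<phi> F = subst3 (\<phi> var_x) (\<phi> var_y) (\<phi> (in_u [:0, 1:])) F"
proof -
  have zero: "\<phi> 0 = 0" using const[of 0] by (simp add: const3_def)
  have u: "\<phi> (in_u h) = h \<circ>\<^sub>p \<phi> (in_u [:0, 1:])" for h
  proof (induction h)
    case (pCons c h)
    have "in_u (pCons c h) = const3 c + in_u [:0, 1:] * in_u h"
      by (simp add: in_u_def const3_def)
    then show ?case by (simp add: add mult const pCons pcompose_pCons)
  qed (simp add: in_u_def zero)
  have y: "\<phi> [:G:] = poly (map_poly (\<lambda>h. h \<circ>\<^sub>p \<phi> (in_u [:0, 1:])) G) (\<phi> var_y)" for G
  proof (induction G)
    case (pCons h G)
    have "[:pCons h G:] = in_u h + var_y * [:G:]" by (simp add: in_u_def var_y_def)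
    then show ?case by (simp only: add mult u[of h] pCons.IH) (simp add: map_poly_pCons)
  qed (simp add: zero)
  show ?thesis
  proof (induction F)
    case (pCons G F)
    have "\<phi> (pCons G F) = \<phi> ([:G:] + var_x * F)" by (simp add: var_x_def)
    also have "\<dots> = \<phi> [:G:] + \<phi> var_x * \<phi> F" by (simp only: add mult)
    finally show ?case by (simp only: y pCons.IH subst3_pCons)
  qed (simp add: zero)
qed

lemma ring_of_type_algebra_simps:
  "carrier ring_of_type_algebra = UNIV" "monoid.mult ring_of_type_algebra = (*)"
  "one ring_of_type_algebra = 1" "ring.zero ring_of_type_algebra = 0" "add ring_of_type_algebra = (+)"
  by (simp_all add: ring_of_type_algebra_def fun_eq_iff)

text \<open>The quotient map, the embedding into the normalization and its isomorphism with k[t]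
  compose to a k-algebra map with kernel \<open>B\<close>; the images of x, y, u are the
  parametrization. Were they all constant, the image would be k and \<open>B\<close>
  maximal.\<close>

lemma affine_line_parametrization:
  fixes B :: "'k::field poly3 set"
  assumes "affine_line_in I B"
  obtains a b c where "B = param_curve a b c"
    "Polynomial.degree a > 0 \<or> Polynomial.degree b > 0 \<or> Polynomial.degree c > 0"
proof -
  let ?R = "ring_of_type_algebra :: 'k poly3 ring"
  have B: "primeideal B ?R" "\<not> maximalideal B ?R"
    using assms by (auto simp: affine_line_in_def closed_curve_in_def)
  obtain h where h: "h \<in> ring_iso (normalization (coord_ring B)) (ring_of_type_algebra :: 'k poly ring)"
    and hc: "\<And>c. h (frac_embed (coord_ring B) (B +>\<^bsub>?R\<^esub> const3 c)) = [:c:]"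
    using assms by (auto simp: affine_line_in_def)
  interpret B: primeideal B ?R by (rule B)
  interpret A: domain "coord_ring B" unfolding coord_ring_def by (rule B.quotient_is_domain)
  define \<phi> where "\<phi> = h \<circ> (frac_embed (coord_ring B) \<circ> (+>\<^bsub>?R\<^esub>) B)"
  have rcos: "(+>\<^bsub>?R\<^esub>) B \<in> ring_hom ?R (coord_ring B)"
    unfolding coord_ring_def by (rule B.rcos_ring_hom)
  have hom: "\<phi> \<in> ring_hom ?R ring_of_type_algebra"
    unfolding \<phi>_def
    using ring_hom_trans[OF ring_hom_trans[OF rcos A.frac_embed_ring_hom]] h by (auto simp: ring_iso_def)
  have add: "\<phi> (F + G) = \<phi> F + \<phi> G" and mult: "\<phi> (F * G) = \<phi> F * \<phi> G" for F G
    using ring_hom_add[OF hom, of F G] ring_hom_mult[OF hom, of F G]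
    by (simp_all add: ring_of_type_algebra_simps)
  have const: "\<phi> (const3 c) = [:c:]" for c by (simp add: \<phi>_def hc)
  have zero: "\<phi> 0 = 0" using const[of 0] by (simp add: const3_def)
  have ker: "\<phi> F = 0 \<longleftrightarrow> F \<in> B" for F
  proof -
    have inj: "inj_on h (carrier (normalization (coord_ring B)))"
      using h by (auto simp: ring_iso_def bij_betw_def)
    have cl: "B +>\<^bsub>?R\<^esub> G \<in> carrier (coord_ring B)" for G
      using ring_hom_closed[OF rcos, of G] by (simp add: ring_of_type_algebra_simps)
    have "\<phi> F = 0 \<longleftrightarrow> \<phi> F = \<phi> 0" by (simp add: zero)
    also have "\<dots> \<longleftrightarrow> frac_embed (coord_ring B) (B +>\<^bsub>?R\<^esub> F) = frac_embed (coord_ring B) (B +>\<^bsub>?R\<^esub> 0)"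
      unfolding \<phi>_def comp_def by (intro inj_on_eq_iff[OF inj] A.frac_embed_in_normalization cl)
    also have "\<dots> \<longleftrightarrow> B +>\<^bsub>?R\<^esub> F = B +>\<^bsub>?R\<^esub> 0"
      by (intro inj_on_eq_iff[OF A.inj_on_frac_embed] cl)
    also have "B +>\<^bsub>?R\<^esub> 0 = B"
      using B.a_coset_add_zero by (simp add: ring_of_type_algebra_simps)
    also have "B +>\<^bsub>?R\<^esub> F = B \<longleftrightarrow> F \<in> B"
      using B.a_rcos_const B.a_rcos_self[of F] by (auto simp: ring_of_type_algebra_simps)
    finally show ?thesis .
  qed
  have subst: "\<phi> F = subst3 (\<phi> var_x) (\<phi> var_y) (\<phi> (in_u [:0, 1:])) F" for F
    by (rule ring_hom_eq_subst3) (simp_all add: add mult const)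
  have curve: "B = param_curve (\<phi> var_x) (\<phi> var_y) (\<phi> (in_u [:0, 1:]))"
    unfolding param_curve_def subst[symmetric] using ker by auto
  have "Polynomial.degree (\<phi> var_x) > 0 \<or> Polynomial.degree (\<phi> var_y) > 0
    \<or> Polynomial.degree (\<phi> (in_u [:0, 1:])) > 0"
  proof (rule ccontr)
    assume "\<not> ?thesis"
    then obtain p q r where pqr: "\<phi> var_x = [:p:]" "\<phi> var_y = [:q:]" "\<phi> (in_u [:0, 1:]) = [:r:]"
      by (auto elim!: degree_eq_zeroE)
    have ex: "\<exists>e. \<phi> F = [:e:]" for F
    proof -
      \<comment> \<open>Constants are unchanged by substituting 0 for t, so the image of
        \<open>F\<close> equals its own value at 0.\<close>
      have "\<phi> F = \<phi> F \<circ>\<^sub>p 0"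
        using subst3_pcompose[of "[:p:]" 0 "[:q:]" "[:r:]" F] subst[of F] pqr by simp
      then show ?thesis by (metis pcompose_0')
    qed
    have "maximalideal B ?R"
    proof (rule maximalidealI)
      show "ideal B ?R" by (rule B.ideal_axioms)
      show "carrier ?R \<noteq> B" by (rule B.I_notcarr)
      fix J assume J: "ideal J ?R" "B \<subseteq> J" "J \<subseteq> carrier ?R"
      interpret J: ideal J ?R by (rule J)
      show "J = B \<or> J = carrier ?R"
      proof (rule disjCI)
        assume "J \<noteq> carrier ?R"
        have "F \<in> B" if F: "F \<in> J" for F
        proof (rule ccontr)
          assume "F \<notin> B"
          obtain e where e: "\<phi> F = [:e:]" using ex by blast
          then have "e \<noteq> 0" using ker[of F] \<open>F \<notin> B\<close> by auto
          \<comment> \<open>Modulo \<open>B\<close>, the element \<open>F\<close> is the nonzero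
            constant \<open>e\<close>, hence invertible; this puts 1 into \<open>J\<close>.\<close>
          have "F * const3 (- 1 / e) + const3 1 \<in> B"
            using ker[of "F * const3 (- 1 / e) + const3 1"] \<open>e \<noteq> 0\<close> by (simp add: add mult const e)
          then have 1: "F * const3 (- 1 / e) + const3 1 \<in> J" using J by blast
          have "F * const3 (1 / e) \<in> J"
            using J.I_r_closed[OF F, of "const3 (1 / e)"] by (simp add: ring_of_type_algebra_simps)
          then have "F * const3 (1 / e) + (F * const3 (- 1 / e) + const3 1) \<in> J"
            using J.a_closed[OF _ 1] by (simp add: ring_of_type_algebra_simps)
          moreover have "F * const3 (1 / e) + (F * const3 (- 1 / e) + const3 1) = 1"
            by (simp add: const3_def one_pCons flip: smult_add_left)
          ultimately have "1 \<in> J" by simp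
          then show False using J.one_imp_carrier \<open>J \<noteq> carrier ?R\<close> by (simp add: ring_of_type_algebra_simps)
        qed
        then show "J = B" using J by blast
      qed
    qed
    then show False using B by blast
  qed
  then show thesis by (rule that[OF curve])
qed

lemma param_curve_pell:
  assumes "pell_surface g \<subseteq> param_curve a b c"
  shows "a ^ 2 - (g \<circ>\<^sub>p c) * b ^ 2 = 1"
proof -
  let ?F = "var_x ^ 2 - in_u g * var_y ^ 2 - 1"
  have "1 * ?F \<in> pell_surface g"
    by (auto simp: pell_surface_def cgenideal_def ring_of_type_algebra_simps simp del: mult_1_left)
  then have "subst3 a b c ?F = 0" using assms by (auto simp: param_curve_def)
  \<comment> \<open>The equation as a polynomial in x, with constant coefficient -1 - g y^2, so that
    \<open>subst3_pCons\<close> evaluates it.\<close>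
  moreover have "?F = [:[:-1, 0, -g:], 0, 1:]"
    by (simp add: var_x_def var_y_def in_u_def power2_eq_square one_pCons)
  ultimately show ?thesis
    by (simp add: subst3_pCons map_poly_pCons pcompose_uminus pcompose_1 power2_eq_square algebra_simps)
qed

theorem theorem2:
  fixes g :: "'k::field poly" and B :: "'k poly3 set"
  assumes "perfect_field TYPE('k)"
    and "CHAR('k) \<noteq> 2"
    and "g \<noteq> 0"
    and "even (Polynomial.degree g)"
    and "affine_line_in (pell_surface g) B"
  shows "vertical_line g B \<or> pell_section g B"
proof -
  have two: "(2::'k) \<noteq> 0" using assms(2) by (rule two_neq_zero)
  obtain a b c where B: "B = param_curve a b c"
    and nonconst: "Polynomial.degree a > 0 \<or> Polynomial.degree b > 0 \<or> Polynomial.degree c > 0"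
    using affine_line_parametrization[OF assms(5)] .
  have pell: "a ^ 2 - (g \<circ>\<^sub>p c) * b ^ 2 = 1"
    using assms(5) B by (intro param_curve_pell) (auto simp: affine_line_in_def closed_curve_in_def)
  show ?thesis
  proof (cases "Polynomial.degree c > 0")
    case True
    obtain v w where vw: "a = v \<circ>\<^sub>p c" "b = w \<circ>\<^sub>p c"
      using pell_descends[OF two pell assms(3,4) True] .
    have "(v ^ 2 - g * w ^ 2 - 1) \<circ>\<^sub>p c = 0"
      using pell by (simp add: vw pcompose_diff pcompose_mult pcompose_power pcompose_1)
    \<comment> \<open>Substitution of the nonconstant \<open>c\<close> is injective, so the Pell
      equation descends to \<open>v\<close>, \<open>w\<close>; the given curve is then the section
      reparametrized by \<open>c\<close>.\<close>
    then have "v ^ 2 - g * w ^ 2 - 1 = 0" using True by (rule pcompose_eq_0)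
    moreover have "B = param_curve v w [:0, 1:]"
      using param_curve_pcompose[OF True, of v w "[:0, 1:]"] by (simp add: B vw pcompose_pCons)
    ultimately have "pell_section g B" unfolding pell_section_def by auto
    then show ?thesis ..
  next
    case False
    then obtain r where r: "c = [:r:]" by (auto elim: degree_eq_zeroE)
    have gr: "g \<circ>\<^sub>p c = [:poly g r:]" unfolding r by (induction g) (simp_all add: pcompose_pCons)
    \<comment> \<open>Otherwise \<open>pell_const\<close> makes \<open>a\<close> and
      \<open>b\<close> constant along with \<open>c\<close>.\<close>
    have root: "poly g r = 0"
    proof (rule ccontr)
      assume "poly g r \<noteq> 0"
      then show False using pell_const[OF two, of a "poly g r" b] pell gr nonconst False by simp
    qed
    then have "(a - 1) * (a + 1) = 0" using pell gr by (simp add: power2_eq_square algebra_simps)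
    then have "a = 1 \<or> a = - 1" by (simp add: eq_neg_iff_add_eq_0)
    then have "a = [:1:] \<or> a = [:-1:]" by (simp add: one_pCons)
    then obtain e where e: "e \<in> {1, -1}" "a = [:e:]" by auto
    then have "Polynomial.degree b > 0" using nonconst False by simp
    \<comment> \<open>Only \<open>b\<close> varies, so it serves as the reparametrization of the
      vertical line.\<close>
    then have "B = param_curve [:e:] [:0, 1:] [:r:]"
      using param_curve_pcompose[of b "[:e:]" "[:0, 1:]" "[:r:]"] by (simp add: B e r pcompose_pCons)
    then have "vertical_line g B" using e root unfolding vertical_line_def by blast
    then show ?thesis ..
  qed
qed

end
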